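(* Let $F:\mathbb{R}^d\to\mathbb{R}$, $F(x)=\sum_{i=1}^n\psi_i(x)$ with $\psi_i:\mathbb{R}^d\to\mathbb{R}$, be $\mu$-strongly convex, and let $\lambda>0$. Given a primal $\big(\frac{2(\mu+\lambda)}{\mu},\lambda\big)$-oracle $\mathcal{P}$ with running time $\mathcal{T}_{\mathcal{P}}$, the algorithm APPA, which starts from $x^{(0)}\in\mathbb{R}^d$, iterates $x^{(t)}\leftarrow\mathcal{P}(x^{(t-1)})$ for $t=1,\dots,T$ and outputs $x^{(T)}$, minimizes $F$ to within accuracy $\epsilon$ in time $$O\big(\mathcal{T}_{\mathcal{P}}\,\lceil\lambda/\mu\rceil\,\log(\epsilon_0/\epsilon)\big).$$ When the oracle is a randomized algorithm, the expected accuracy is at most $\epsilon$.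
   Context: For $s\in\mathbb{R}^d$ and $\lambda>0$ let $f_{s,\lambda}(x)=F(x)+\frac\lambda2\|x-s\|_2^2$ and $f_{s,\lambda}^{\mathrm{opt}}=\min_xf_{s,\lambda}(x)$. A point $x'$ is an $\epsilon$-approximate minimizer of $f$ if $f(x')-\min f\le\epsilon$; minimizing $F$ to within accuracy $\epsilon$ means outputting an $\epsilon$-approximate minimizer of $F$. An algorithm $\mathcal{P}$ is a primal $(c,\lambda)$-oracle if, given $x\in\mathbb{R}^d$, it outputs $\mathcal{P}(x)$ that is a $\frac1c\big[f_{x,\lambda}(x)-f_{x,\lambda}^{\mathrm{opt}}\big]$-approximate minimizer of $f_{x,\lambda}$, in time $\mathcal{T}_{\mathcal{P}}$; when $\mathcal{P}$ is randomized, the error bound is required in expectation. $\epsilon_0=F(x^{(0)})-\min_xF(x)$ is the initial error, and the number of iterations $T$ is chosen according to the target accuracy $\epsilon$. *)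

theory Defs
  imports "HOL-Probability.Probability"
begin

definition strongly_convex :: "real \<Rightarrow> ('a::real_normed_vector \<Rightarrow> real) \<Rightarrow> bool" where
  "strongly_convex \<mu> f \<longleftrightarrow>
    (\<forall>x y. \<forall>t\<in>{0..1}. f (t *\<^sub>R x + (1 - t) *\<^sub>R y)
       \<le> t * f x + (1 - t) * f y - \<mu> / 2 * t * (1 - t) * (norm (x - y))\<^sup>2)"

text \<open>\<open>LEAST\<close> picks the least element of the range itself, so this is a minimum, not just
  an infimum; it is unspecified when no minimum is attained.\<close>

definition min_value :: "('a \<Rightarrow> real) \<Rightarrow> real" where
  "min_value f = (LEAST v. v \<in> range f)"

definition approx_minimizer :: "('a \<Rightarrow> real) \<Rightarrow> real \<Rightarrow> 'a \<Rightarrow> bool" where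
  "approx_minimizer f \<epsilon> x' \<longleftrightarrow> f x' - min_value f \<le> \<epsilon>"

text \<open>The Bochner integral of a non-integrable function is \<open>0\<close>, hence the explicit
  integrability.\<close>

definition expected_approx_minimizer :: "('a \<Rightarrow> real) \<Rightarrow> real \<Rightarrow> 'a measure \<Rightarrow> bool" where
  "expected_approx_minimizer f \<epsilon> M \<longleftrightarrow>
     integrable M (\<lambda>x'. f x' - min_value f) \<and> (LINT x'|M. f x' - min_value f) \<le> \<epsilon>"

definition prox_fun :: "('a::real_normed_vector \<Rightarrow> real) \<Rightarrow> 'a \<Rightarrow> real \<Rightarrow> 'a \<Rightarrow> real" where
  "prox_fun F s l = (\<lambda>x. F x + l / 2 * (norm (x - s))\<^sup>2)"

text \<open>A deterministic algorithm is a function returning its output paired with the time spent on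
  that input. A randomized algorithm returns a probability distribution on such pairs and is
  a Markov kernel, so that successive calls, each with fresh randomness, compose by the Giry
  monad's bind.\<close>

definition primal_oracle ::
    "('a::real_normed_vector \<Rightarrow> real) \<Rightarrow> real \<Rightarrow> real \<Rightarrow> real \<Rightarrow> ('a \<Rightarrow> 'a \<times> real) \<Rightarrow> bool" where
  "primal_oracle F c l \<tau> P \<longleftrightarrow>
    (\<forall>x. approx_minimizer (prox_fun F x l)
           (1 / c * (prox_fun F x l x - min_value (prox_fun F x l))) (fst (P x))
       \<and> 0 \<le> snd (P x) \<and> snd (P x) \<le> \<tau>)"

definition randomized_primal_oracle ::
    "('a::euclidean_space \<Rightarrow> real) \<Rightarrow> real \<Rightarrow> real \<Rightarrow> real \<Rightarrow> ('a \<Rightarrow> ('a \<times> real) measure) \<Rightarrow> bool" where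
  "randomized_primal_oracle F c l \<tau> P \<longleftrightarrow>
    P \<in> borel \<rightarrow>\<^sub>M prob_algebra (borel \<Otimes>\<^sub>M borel) \<and>
    (\<forall>x. expected_approx_minimizer (prox_fun F x l)
           (1 / c * (prox_fun F x l x - min_value (prox_fun F x l))) (distr (P x) borel fst)
       \<and> (AE (x', s) in P x. 0 \<le> s \<and> s \<le> \<tau>))"

text \<open>The algorithm APPA after a given number of iterations: current iterate and total time
  spent in the oracle so far.\<close>

primrec appa :: "('a \<Rightarrow> 'a \<times> real) \<Rightarrow> 'a \<Rightarrow> nat \<Rightarrow> 'a \<times> real" where
  "appa P x0 0 = (x0, 0)"
| "appa P x0 (Suc t) =
     (let (x, s) = appa P x0 t; (x', s') = P x in (x', s + s'))"

primrec randomized_appa ::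
    "('a::euclidean_space \<Rightarrow> ('a \<times> real) measure) \<Rightarrow> 'a \<Rightarrow> nat \<Rightarrow> ('a \<times> real) measure" where
  "randomized_appa P x0 0 = return (borel \<Otimes>\<^sub>M borel) (x0, 0)"
| "randomized_appa P x0 (Suc t) =
     randomized_appa P x0 t \<bind>
       (\<lambda>(x, s). distr (P x) (borel \<Otimes>\<^sub>M borel) (\<lambda>(x', s'). (x', s + s')))"

text \<open>The absolute constant hidden in the \<open>O\<close>-notation. It is a numeral because the
  dimension is a type: an existentially quantified constant could depend on the dimension.\<close>

definition appa_const :: real where
  "appa_const = 5"

text \<open>The logarithm is read as at least \<open>1\<close>, as usual inside \<open>O\<close>: when \<open>\<epsilon>\<close> is only slightly
  below \<open>\<epsilon>0\<close>, one iteration can be needed although \<open>ln (\<epsilon>0 / \<epsilon>)\<close> is arbitrarily small.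
  For \<open>\<epsilon>0 = 0\<close> the quotient and its logarithm are \<open>0\<close>.\<close>

definition appa_time_bound :: "real \<Rightarrow> real \<Rightarrow> real \<Rightarrow> real \<Rightarrow> real \<Rightarrow> real" where
  "appa_time_bound \<tau> l \<mu> \<epsilon>0 \<epsilon> =
     appa_const * (\<tau> * of_int \<lceil>l / \<mu>\<rceil> * max 1 (ln (\<epsilon>0 / \<epsilon>)))"

end

theory Submission
  imports Defs
begin

text \<open>Moving from \<open>x\<close> towards the minimizer of \<open>F\<close> by the fraction \<open>\<mu> / (\<mu> + \<lambda>)\<close> makes the strong
  convexity gain cancel the proximal penalty, so the minimum of the proximal objective exceeds that
  of \<open>F\<close> by at most \<open>\<lambda> / (\<mu> + \<lambda>)\<close> times the error of \<open>x\<close>. The oracle adds at most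
  \<open>\<mu> / (2 (\<mu> + \<lambda>))\<close> times that error. Each iteration therefore contracts the (expected) error by
  \<open>1 - \<mu> / (2 (\<mu> + \<lambda>))\<close>.\<close>

section \<open>Existence of minimizers for strongly convex functions\<close>

lemma min_value_eqI:
  assumes "\<And>x. f z \<le> f x"
  shows "min_value f = f z"
  unfolding min_value_def using assms by (auto intro!: Least_equality)

text \<open>The sublevel set is compact and contains \<open>x0\<close>, so \<open>f\<close> has a
  minimum on it; every point outside has a value above \<open>f x0\<close>.\<close>

lemma continuous_attains_min_if_bounded_sublevel:
  fixes f :: "'a::euclidean_space \<Rightarrow> real"
  assumes "continuous_on UNIV f" "bounded {x. f x \<le> f x0}"
  shows "\<exists>z. \<forall>x. f z \<le> f x"
proof -
  have "closed {x. f x \<le> f x0}"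
    using assms(1) by (intro closed_Collect_le) (auto intro: continuous_intros)
  then have "compact {x. f x \<le> f x0}"
    using assms(2) by (simp add: compact_eq_bounded_closed)
  moreover have "continuous_on {x. f x \<le> f x0} f"
    using assms(1) by (rule continuous_on_subset) simp
  ultimately obtain z where "z \<in> {x. f x \<le> f x0}" "\<forall>x\<in>{x. f x \<le> f x0}. f z \<le> f x"
    using continuous_attains_inf[of "{x. f x \<le> f x0}" f] by blast
  then have "f z \<le> f x" for x
    by (cases "f x \<le> f x0") auto
  then show ?thesis by blast
qed

lemma strongly_convexD:
  assumes "strongly_convex \<mu> f" "0 \<le> t" "t \<le> 1"
  shows "f (t *\<^sub>R x + (1 - t) *\<^sub>R y)
    \<le> t * f x + (1 - t) * f y - \<mu> / 2 * t * (1 - t) * (norm (x - y))\<^sup>2"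
  using assms by (simp add: strongly_convex_def)

lemma strongly_convex_continuous_on:
  fixes f :: "'a::euclidean_space \<Rightarrow> real"
  assumes "\<mu> \<ge> 0" "strongly_convex \<mu> f"
  shows "continuous_on UNIV f"
proof (rule convex_on_continuous)
  show "convex_on UNIV f"
  proof
    fix t :: real and x y :: 'a
    assume t: "t > 0" "t < 1"
    have "f (t *\<^sub>R y + (1 - t) *\<^sub>R x) \<le> t * f y + (1 - t) * f x - \<mu> / 2 * t * (1 - t) * (norm (y - x))\<^sup>2"
      using t by (intro strongly_convexD[OF assms(2)]) auto
    moreover have "\<mu> / 2 * t * (1 - t) * (norm (y - x))\<^sup>2 \<ge> 0"
      using assms(1) t by simp
    ultimately show "f ((1 - t) *\<^sub>R x + t *\<^sub>R y) \<le> (1 - t) * f x + t * f y"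
      by (simp add: add.commute)
  qed simp
qed simp

text \<open>If \<open>x\<close> lies far from \<open>x0\<close> with \<open>f x \<le> f x0\<close>,
  strong convexity forces \<open>f\<close> at distance 1 from \<open>x0\<close> on the segment
  towards \<open>x\<close> below \<open>f x0\<close> by an amount linear in the distance. The
  minimum of \<open>f\<close> over the unit ball around \<open>x0\<close> limits that drop, hence
  the distance.\<close>

lemma strongly_convex_bounded_sublevel:
  fixes f :: "'a::euclidean_space \<Rightarrow> real"
  assumes "\<mu> > 0" "strongly_convex \<mu> f"
  shows "bounded {x. f x \<le> f x0}"
proof -
  have "continuous_on (cball x0 1) f"
    using strongly_convex_continuous_on[of \<mu> f] assms by (auto intro: continuous_on_subset)
  then obtain z where z: "\<And>y. y \<in> cball x0 1 \<Longrightarrow> f z \<le> f y"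
    using continuous_attains_inf[of "cball x0 1" f] by (auto simp del: mem_cball)
  have "dist x0 x \<le> 1 + 2 * (f x0 - f z) / \<mu>" if x: "f x \<le> f x0" for x
  proof (cases "dist x0 x \<le> 1")
    case True
    moreover have "f z \<le> f x0" by (rule z) simp
    ultimately show ?thesis using assms(1) by (simp add: add_increasing2)
  next
    case False
    define r where "r = norm (x - x0)"
    have r: "r > 1" using False by (simp add: r_def dist_norm norm_minus_commute)
    \<comment> \<open>The point where the segment from \<open>x0\<close> to \<open>x\<close> leaves
      the unit ball around \<open>x0\<close>.\<close>
    let ?y = "(1 / r) *\<^sub>R x + (1 - 1 / r) *\<^sub>R x0"
    have "?y - x0 = (1 / r) *\<^sub>R (x - x0)" by (simp add: algebra_simps)
    then have "norm (?y - x0) = \<bar>1 / r\<bar> * r" by (simp only: norm_scaleR r_def)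
    then have "norm (?y - x0) = 1" using r by simp
    then have "f z \<le> f ?y" by (intro z) (simp add: dist_norm norm_minus_commute)
    also have "\<dots> \<le> 1 / r * f x + (1 - 1 / r) * f x0 - \<mu> / 2 * (1 / r) * (1 - 1 / r) * r\<^sup>2"
      using strongly_convexD[OF assms(2), of "1 / r" x x0] r by (simp add: r_def[symmetric])
    also have "\<dots> \<le> 1 / r * f x0 + (1 - 1 / r) * f x0 - \<mu> / 2 * (1 / r) * (1 - 1 / r) * r\<^sup>2"
      using x r by (simp add: divide_right_mono)
    also have "\<dots> = f x0 - \<mu> / 2 * (r - 1)"
      using r by (simp add: field_simps power2_eq_square)
    finally show ?thesis
      using assms(1) by (simp add: r_def dist_norm norm_minus_commute field_simps)
  qed
  then show ?thesis
    by (auto simp: bounded_def)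
qed

lemma strongly_convex_min_value:
  fixes f :: "'a::euclidean_space \<Rightarrow> real"
  assumes "\<mu> > 0" "strongly_convex \<mu> f"
  obtains z where "min_value f = f z" "\<And>x. f z \<le> f x"
proof -
  have "continuous_on UNIV f"
    using assms by (intro strongly_convex_continuous_on[of \<mu>]) auto
  then obtain z where "\<And>x. f z \<le> f x"
    using continuous_attains_min_if_bounded_sublevel strongly_convex_bounded_sublevel[OF assms] by blast
  with min_value_eqI[of f z] show ?thesis
    using that by blast
qed

section \<open>The proximal objective and existence of its minimizer\<close>

lemma prox_fun_self [simp]: "prox_fun F s l s = F s"
  by (simp add: prox_fun_def)

lemma prox_fun_ge: "l \<ge> 0 \<Longrightarrow> F x \<le> prox_fun F s l x"
  by (simp add: prox_fun_def)

text \<open>The proximal objective dominates \<open>F\<close> and agrees with it at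
  \<open>s\<close>, so its sublevel set through \<open>s\<close> lies inside the bounded one of
  \<open>F\<close>.\<close>

lemma prox_fun_min_value:
  fixes F :: "'a::euclidean_space \<Rightarrow> real"
  assumes "\<mu> > 0" "strongly_convex \<mu> F" "l \<ge> 0"
  obtains z where "min_value (prox_fun F s l) = prox_fun F s l z"
    "\<And>x. prox_fun F s l z \<le> prox_fun F s l x"
proof -
  have "continuous_on UNIV (prox_fun F s l)"
    unfolding prox_fun_def using assms
    by (intro continuous_intros strongly_convex_continuous_on[of \<mu>]) auto
  moreover have "bounded {x. prox_fun F s l x \<le> prox_fun F s l s}"
    by (rule bounded_subset[OF strongly_convex_bounded_sublevel[OF assms(1,2), of s]])
      (use prox_fun_ge[OF assms(3), of F] in \<open>auto intro: order_trans\<close>)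
  ultimately obtain z where "\<And>x. prox_fun F s l z \<le> prox_fun F s l x"
    using continuous_attains_min_if_bounded_sublevel by blast
  with min_value_eqI[of "prox_fun F s l" z] show ?thesis
    using that by blast
qed

section \<open>Error bounds for a single proximal step\<close>

locale proximal_problem =
  fixes F :: "'a::euclidean_space \<Rightarrow> real" and \<mu> l :: real
  assumes \<mu>_pos: "\<mu> > 0" and strongly_convex: "strongly_convex \<mu> F" and l_pos: "l > 0"
begin

definition gap :: "'a \<Rightarrow> real" where
  "gap x = F x - min_value F"

abbreviation prox_min :: "'a \<Rightarrow> real" where
  "prox_min x \<equiv> min_value (prox_fun F x l)"

definition contraction :: real where
  "contraction = 1 - \<mu> / (2 * (\<mu> + l))"

lemma contraction_bounds: "0 < contraction" "contraction < 1"
  using \<mu>_pos l_pos by (auto simp: contraction_def field_simps)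

lemma gap_nonneg: "0 \<le> gap x"
  using strongly_convex_min_value[OF \<mu>_pos strongly_convex] unfolding gap_def
  by (metis diff_ge_0_iff_ge)

lemma gap_measurable [measurable]: "gap \<in> borel_measurable borel"
  unfolding gap_def using \<mu>_pos strongly_convex
  by (intro borel_measurable_continuous_onI continuous_intros strongly_convex_continuous_on) auto

text \<open>Lets the proximal error of the center \<open>x\<close> be bounded by
  \<open>gap x\<close>, and makes the excess of the proximal minimum nonnegative.\<close>

lemma min_value_le_prox_min: "min_value F \<le> prox_min x"
proof -
  obtain z where "prox_min x = prox_fun F x l z"
    using prox_fun_min_value[OF \<mu>_pos strongly_convex] l_pos by (metis less_imp_le)
  then show ?thesis
    using gap_nonneg[of z] prox_fun_ge[of l F z x] l_pos by (simp add: gap_def)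
qed

lemma prox_min_le: "prox_min x \<le> prox_fun F x l y"
  using prox_fun_min_value[OF \<mu>_pos strongly_convex] l_pos by (metis less_imp_le)

lemma prox_min_gap: "prox_min x - min_value F \<le> l / (\<mu> + l) * gap x"
proof -
  obtain z where z: "min_value F = F z" "\<And>x. F z \<le> F x"
    using strongly_convex_min_value[OF \<mu>_pos strongly_convex] by blast
  \<comment> \<open>The weight is the solution of \<open>\<mu> * (1 - t) = l * t\<close>.\<close>
  define t where "t = \<mu> / (\<mu> + l)"
  have t: "0 \<le> t" "t \<le> 1" and t': "1 - t = l / (\<mu> + l)" and cancel: "\<mu> * (1 - t) = l * t"
    using \<mu>_pos l_pos by (auto simp: t_def field_simps)
  let ?y = "t *\<^sub>R z + (1 - t) *\<^sub>R x"
  have "?y - x = t *\<^sub>R (z - x)" by (simp add: algebra_simps)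
  then have n: "(norm (?y - x))\<^sup>2 = t\<^sup>2 * (norm (z - x))\<^sup>2"
    by (simp add: power_mult_distrib)
  have "F ?y \<le> t * F z + (1 - t) * F x - \<mu> / 2 * t * (1 - t) * (norm (z - x))\<^sup>2"
    using t by (intro strongly_convexD[OF strongly_convex])
  \<comment> \<open>Multiplying \<open>cancel\<close> by
    \<open>t * (norm (z - x))\<^sup>2 / 2\<close> turns the strong convexity gain into exactly the
    penalty at \<open>?y\<close>.\<close>
  moreover have "\<mu> / 2 * t * (1 - t) * (norm (z - x))\<^sup>2 = l / 2 * (t\<^sup>2 * (norm (z - x))\<^sup>2)"
    using arg_cong[OF cancel, of "\<lambda>u. u * t * (norm (z - x))\<^sup>2 / 2"]
    by (simp add: power2_eq_square mult_ac)
  ultimately have "prox_fun F x l ?y \<le> t * F z + (1 - t) * F x"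
    unfolding prox_fun_def n by linarith
  with prox_min_le[of x ?y] have "prox_min x \<le> t * F z + (1 - t) * F x" by linarith
  then have "prox_min x - F z \<le> (1 - t) * (F x - F z)" by (simp add: algebra_simps)
  then show ?thesis by (simp add: z t' gap_def)
qed

text \<open>The left side adds the error allowed to the oracle and the excess of the proximal
  minimum over that of \<open>F\<close>. It is the common core of the deterministic and the expected
  contraction.\<close>

lemma oracle_error_contraction:
  "1 / (2 * (\<mu> + l) / \<mu>) * (prox_fun F x l x - prox_min x) + (prox_min x - min_value F)
    \<le> contraction * gap x"
proof -
  \<comment> \<open>\<open>a\<close> is the reciprocal of the oracle constant and \<open>b\<close>
    the coefficient in \<open>prox_min_gap\<close>. From \<open>a = c / 2\<close> and
    \<open>c + b = 1\<close> follows \<open>1 - a = a + b\<close>.\<close>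
  define a b c where "a = \<mu> / (2 * (\<mu> + l))" and "b = l / (\<mu> + l)" and "c = \<mu> / (\<mu> + l)"
  have "a = c / 2" by (simp add: a_def c_def)
  moreover have "c + b = 1"
    using \<mu>_pos l_pos by (simp add: b_def c_def add_divide_distrib[symmetric])
  moreover have "contraction = 1 - a" by (simp add: contraction_def a_def)
  ultimately have "contraction = a + b" by linarith
  then have "contraction * gap x = a * gap x + b * gap x" by (simp add: distrib_right)
  moreover have "1 / (2 * (\<mu> + l) / \<mu>) * (prox_fun F x l x - prox_min x) \<le> a * gap x"
    using \<mu>_pos l_pos min_value_le_prox_min[of x]
    by (simp add: gap_def a_def divide_right_mono)
  ultimately show ?thesis using prox_min_gap[of x] by (simp add: b_def)
qed

lemma gap_le_prox_gap: "gap y \<le> (prox_fun F x l y - prox_min x) + (prox_min x - min_value F)"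
  using prox_fun_ge[of l F y x] l_pos by (simp add: gap_def)

section \<open>Iteration with a deterministic oracle\<close>

lemma appa_contraction:
  assumes P: "primal_oracle F (2 * (\<mu> + l) / \<mu>) l \<tau> P"
  shows "gap (fst (appa P x0 T)) \<le> contraction ^ T * gap x0 \<and> snd (appa P x0 T) \<le> T * \<tau>"
proof (induction T)
  case (Suc T)
  obtain x s where xs: "appa P x0 T = (x, s)" by fastforce
  obtain x' s' where xs': "P x = (x', s')" by fastforce
  have "prox_fun F x l x' - prox_min x
      \<le> 1 / (2 * (\<mu> + l) / \<mu>) * (prox_fun F x l x - prox_min x) \<and> s' \<le> \<tau>"
    using P[unfolded primal_oracle_def approx_minimizer_def, rule_format, of x]
    unfolding xs' fst_conv snd_conv by blast
  with gap_le_prox_gap[of x' x] oracle_error_contraction[of x]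
  have "gap x' \<le> contraction * gap x" "s' \<le> \<tau>" by linarith+
  moreover have "contraction * gap x \<le> contraction * (contraction ^ T * gap x0)"
    using Suc xs contraction_bounds by (intro mult_left_mono) auto
  ultimately show ?case
    using Suc by (auto simp: xs xs' algebra_simps)
qed simp

section \<open>Iteration with a randomized oracle\<close>

lemma nn_integral_oracle_gap:
  assumes "randomized_primal_oracle F (2 * (\<mu> + l) / \<mu>) l \<tau> P"
  shows "(\<integral>\<^sup>+p. gap (fst p) \<partial>P x) \<le> ennreal (contraction * gap x)"
proof -
  let ?h = "\<lambda>y. prox_fun F x l y - prox_min x"
  let ?M = "distr (P x) borel fst"
  have "P \<in> borel \<rightarrow>\<^sub>M prob_algebra (borel \<Otimes>\<^sub>M borel)"
    using assms by (simp add: randomized_primal_oracle_def)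
  then have P: "sets (P x) = sets (borel \<Otimes>\<^sub>M borel)" "prob_space (P x)"
    using measurable_space[of P borel "prob_algebra (borel \<Otimes>\<^sub>M borel)" x]
    by (auto simp: space_prob_algebra)
  have fst_meas: "fst \<in> P x \<rightarrow>\<^sub>M borel"
    using P(1) measurable_cong_sets by blast
  then interpret prob_space ?M by (rule prob_space.prob_space_distr[OF P(2)])
  have h: "integrable ?M ?h"
    "(LINT y|?M. ?h y) \<le> 1 / (2 * (\<mu> + l) / \<mu>) * (prox_fun F x l x - prox_min x)"
    using assms unfolding randomized_primal_oracle_def expected_approx_minimizer_def by blast+
  have h_nonneg: "0 \<le> ?h y" for y using prox_min_le[of x y] by simp
  have d_nonneg: "0 \<le> prox_min x - min_value F" using min_value_le_prox_min[of x] by simp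
  have "(\<integral>\<^sup>+p. gap (fst p) \<partial>P x) = (\<integral>\<^sup>+y. gap y \<partial>?M)"
    using fst_meas by (subst nn_integral_distr) auto
  \<comment> \<open>The dominating function is nonnegative and integrable by the oracle property, so
    its nonnegative integral can be turned into the expectation that the oracle bounds.\<close>
  also have "\<dots> \<le> (\<integral>\<^sup>+y. ennreal (?h y + (prox_min x - min_value F)) \<partial>?M)"
    by (intro nn_integral_mono ennreal_leI gap_le_prox_gap)
  also have "\<dots> = ennreal (LINT y|?M. ?h y + (prox_min x - min_value F))"
    by (intro nn_integral_eq_integral Bochner_Integration.integrable_add h(1) integrable_const
        AE_I2 add_nonneg_nonneg h_nonneg d_nonneg)
  also have "(LINT y|?M. ?h y + (prox_min x - min_value F)) = (LINT y|?M. ?h y) + (prox_min x - min_value F)"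
    by (subst Bochner_Integration.integral_add[OF h(1)]) (use prob_space in auto)
  also have "ennreal \<dots> \<le> ennreal (contraction * gap x)"
    using h(2) oracle_error_contraction[of x] by (intro ennreal_leI) linarith
  finally show ?thesis .
qed

text \<open>The one-step transition inside \<open>randomized_appa\<close>, named so that the rules
  for \<open>bind\<close> can be applied to it.\<close>

definition oracle_kernel :: "('a \<Rightarrow> ('a \<times> real) measure) \<Rightarrow> 'a \<times> real \<Rightarrow> ('a \<times> real) measure" where
  "oracle_kernel P = (\<lambda>(x, s). distr (P x) (borel \<Otimes>\<^sub>M borel) (\<lambda>(x', s'). (x', s + s')))"

lemma measurable_oracle_kernel:
  assumes "P \<in> borel \<rightarrow>\<^sub>M prob_algebra (borel \<Otimes>\<^sub>M borel)"
  shows "oracle_kernel P \<in> borel \<Otimes>\<^sub>M borel \<rightarrow>\<^sub>M prob_algebra (borel \<Otimes>\<^sub>M borel)"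
proof -
  note assms [measurable]
  \<comment> \<open>The map pushed forward varies with the state through the elapsed time
    \<open>snd z\<close>, so joint measurability in \<open>z\<close> and \<open>w\<close> is
    required.\<close>
  have "(\<lambda>z. distr (P (fst z)) (borel \<Otimes>\<^sub>M borel) ((\<lambda>z w. (fst w, snd z + snd w)) z))
      \<in> borel \<Otimes>\<^sub>M borel \<rightarrow>\<^sub>M prob_algebra (borel \<Otimes>\<^sub>M (borel :: real measure))"
    by (rule measurable_distr_prob_space2[where M = "borel \<Otimes>\<^sub>M borel"]) measurable
  then show ?thesis by (simp add: oracle_kernel_def case_prod_beta')
qed

text \<open>One induction serves all three claims, since the last two integrate over the law that
  the first makes a probability measure. Stating the error as a nonnegative integral lets it pass
  through \<open>bind\<close> before integrability of \<open>gap\<close> is known.\<close>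

lemma randomized_appa_contraction:
  assumes P: "randomized_primal_oracle F (2 * (\<mu> + l) / \<mu>) l \<tau> P"
  shows "randomized_appa P x0 T \<in> space (prob_algebra (borel \<Otimes>\<^sub>M borel))"
    and "(\<integral>\<^sup>+p. gap (fst p) \<partial>randomized_appa P x0 T) \<le> ennreal (contraction ^ T * gap x0)"
    and "AE p in randomized_appa P x0 T. snd p \<le> T * \<tau>"
proof (induction T)
  case 0
  { case 1 show ?case
      by (auto simp: space_prob_algebra space_pair_measure intro!: prob_space_return) }
  { case 2 show ?case by (simp add: nn_integral_return space_pair_measure) }
  { case 3
    have "Measurable.pred (borel \<Otimes>\<^sub>M borel) (\<lambda>p :: 'a \<times> real. snd p \<le> real 0 * \<tau>)"
      by measurable
    then show ?case
      unfolding randomized_appa.simps by (subst AE_return) (simp_all add: space_pair_measure) }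
next
  case (Suc T)
  let ?M = "randomized_appa P x0 T" and ?B = "borel \<Otimes>\<^sub>M borel :: ('a \<times> real) measure"
  have P_meas: "P \<in> borel \<rightarrow>\<^sub>M prob_algebra ?B"
    using P by (simp add: randomized_primal_oracle_def)
  have eq: "randomized_appa P x0 (Suc T) = ?M \<bind> oracle_kernel P"
    by (simp add: oracle_kernel_def)
  note K = measurable_oracle_kernel[OF P_meas]
  have M: "sets ?M = sets ?B" "space ?M = UNIV"
    using Suc(1) by (auto simp: space_prob_algebra space_pair_measure dest: sets_eq_imp_space_eq)
  have K': "oracle_kernel P \<in> ?M \<rightarrow>\<^sub>M subprob_algebra ?B"
    using measurable_prob_algebraD[OF K] measurable_cong_sets[OF M(1) refl] by blast
  have "sets (P x) = sets ?B" for x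
    using measurable_space[OF P_meas, of x] by (auto simp: space_prob_algebra)
  then have shift: "(\<lambda>w. (fst w, s + snd w)) \<in> P x \<rightarrow>\<^sub>M ?B" for x and s :: real
    by (subst measurable_cong_sets[OF _ refl]) measurable
  { case 1 show ?case
      unfolding eq using prob_space_bind'[OF Suc(1) K] sets_bind'[OF Suc(1) K]
      by (simp add: space_prob_algebra) }
  { case 2
    have "(\<integral>\<^sup>+p. gap (fst p) \<partial>randomized_appa P x0 (Suc T))
        = (\<integral>\<^sup>+z. \<integral>\<^sup>+p. gap (fst p) \<partial>oracle_kernel P z \<partial>?M)"
      unfolding eq by (rule nn_integral_bind[OF _ K']) measurable
    \<comment> \<open>The kernel differs from \<open>P\<close> only by a shift of the time
      component, which the error ignores.\<close>
    also have "\<dots> = (\<integral>\<^sup>+z. \<integral>\<^sup>+p. gap (fst p) \<partial>P (fst z) \<partial>?M)"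
      by (intro nn_integral_cong)
        (auto simp: oracle_kernel_def case_prod_beta' nn_integral_distr shift)
    also have "\<dots> \<le> (\<integral>\<^sup>+z. ennreal contraction * ennreal (gap (fst z)) \<partial>?M)"
      using nn_integral_oracle_gap[OF P] contraction_bounds gap_nonneg
      by (intro nn_integral_mono) (simp add: ennreal_mult)
    also have "\<dots> = ennreal contraction * (\<integral>\<^sup>+z. gap (fst z) \<partial>?M)"
      by (rule nn_integral_cmult) (subst measurable_cong_sets[OF M(1) refl], measurable)
    also have "\<dots> \<le> ennreal contraction * ennreal (contraction ^ T * gap x0)"
      by (intro mult_left_mono Suc(2)) simp
    also have "\<dots> = ennreal (contraction ^ Suc T * gap x0)"
      using contraction_bounds gap_nonneg[of x0] by (simp add: ennreal_mult[symmetric] mult.assoc)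
    finally show ?case . }
  { case 3
    \<comment> \<open>By induction almost every state \<open>z\<close> satisfies this premise;
      \<open>AE_bind\<close> then joins the two almost sure statements.\<close>
    have "AE p in oracle_kernel P z. snd p \<le> Suc T * \<tau>" if z: "snd z \<le> T * \<tau>" for z
    proof -
      have "AE w in P (fst z). 0 \<le> snd w \<and> snd w \<le> \<tau>"
        using P unfolding randomized_primal_oracle_def by (simp add: case_prod_beta')
      then have "AE w in P (fst z). snd z + snd w \<le> Suc T * \<tau>"
        by eventually_elim (use z in \<open>simp add: algebra_simps\<close>)
      moreover have "{p \<in> space ?B. snd p \<le> Suc T * \<tau>} \<in> sets ?B" by measurable
      ultimately show ?thesis
        unfolding oracle_kernel_def case_prod_beta' by (subst AE_distr_iff[OF shift]) simp_all
    qed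
    with Suc(3) have "AE z in ?M. AE p in oracle_kernel P z. snd p \<le> Suc T * \<tau>"
      by auto
    then show ?case unfolding eq by (subst AE_bind[OF K']) measurable }
qed

text \<open>The time of a call lies between 0 and \<open>\<tau>\<close> almost surely, and under a
  probability measure an almost sure constant statement is true. The input \<open>undefined\<close>
  stands for an arbitrary point.\<close>

lemma randomized_oracle_time_nonneg:
  assumes P: "randomized_primal_oracle F c l \<tau> P"
  shows "0 \<le> \<tau>"
proof -
  have "P \<in> borel \<rightarrow>\<^sub>M prob_algebra (borel \<Otimes>\<^sub>M borel)" "AE (x', s) in P undefined. 0 \<le> s \<and> s \<le> \<tau>"
    using P by (auto simp: randomized_primal_oracle_def)
  then have "prob_space (P undefined)" "AE w in P undefined. 0 \<le> \<tau>"
    using measurable_space[of P borel "prob_algebra (borel \<Otimes>\<^sub>M borel)" undefined]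
    by (auto simp: space_prob_algebra)
  then show ?thesis using prob_space.AE_const by blast
qed

lemma randomized_appa_expected_approx_minimizer:
  assumes P: "randomized_primal_oracle F (2 * (\<mu> + l) / \<mu>) l \<tau> P"
    and \<epsilon>: "contraction ^ T * gap x0 \<le> \<epsilon>"
  shows "expected_approx_minimizer F \<epsilon> (distr (randomized_appa P x0 T) borel fst)"
proof -
  let ?M = "randomized_appa P x0 T"
  have "sets ?M = sets (borel \<Otimes>\<^sub>M borel)"
    using randomized_appa_contraction(1)[OF P] by (simp add: space_prob_algebra)
  then have fst_meas: "fst \<in> ?M \<rightarrow>\<^sub>M borel"
    using measurable_cong_sets by blast
  have le: "(\<integral>\<^sup>+y. gap y \<partial>distr ?M borel fst) \<le> ennreal (contraction ^ T * gap x0)"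
    using randomized_appa_contraction(2)[OF P, of x0 T] fst_meas by (simp add: nn_integral_distr)
  \<comment> \<open>Nonnegativity of \<open>gap\<close> and the finite bound \<open>le\<close> give
    integrability, which permits the return to the Bochner integral.\<close>
  have int: "integrable (distr ?M borel fst) gap"
    by (rule integrableI_nonneg)
      (use le gap_nonneg in \<open>auto simp: le_less_trans[OF _ ennreal_less_top]\<close>)
  then have "ennreal (LINT y|distr ?M borel fst. gap y) \<le> ennreal (contraction ^ T * gap x0)"
    using le gap_nonneg by (subst (asm) nn_integral_eq_integral) auto
  then have "(LINT y|distr ?M borel fst. gap y) \<le> contraction ^ T * gap x0"
    using contraction_bounds gap_nonneg by (subst (asm) ennreal_le_iff) auto
  with \<epsilon> int show ?thesis
    by (simp add: expected_approx_minimizer_def flip: gap_def)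
qed

section \<open>Choice of the iteration count, and the final time bound\<close>

lemma iteration_count:
  assumes "\<epsilon> > 0"
  obtains T :: nat where "contraction ^ T * gap x0 \<le> \<epsilon>"
    "real T \<le> appa_const * (of_int \<lceil>l / \<mu>\<rceil> * max 1 (ln (gap x0 / \<epsilon>)))"
proof -
  have k: "real_of_int \<lceil>l / \<mu>\<rceil> \<ge> 1" using \<mu>_pos l_pos by simp
  show ?thesis
  proof (cases "gap x0 \<le> \<epsilon>")
    case True
    \<comment> \<open>The start is already accurate enough; this includes
      \<open>gap x0 = 0\<close>.\<close>
    then show ?thesis using k by (intro that[of 0]) (auto simp: appa_const_def)
  next
    case False
    define L where "L = ln (gap x0 / \<epsilon>)"
    \<comment> \<open>The factor of \<open>L\<close> is the reciprocal of
      \<open>1 - contraction\<close>. By \<open>1 - u \<le> exp (- u)\<close>, this many iterations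
      shrink the error by at least \<open>exp (- L)\<close>, which is
      \<open>\<epsilon> / gap x0\<close>.\<close>
    define T where "T = nat \<lceil>2 * (\<mu> + l) / \<mu> * L\<rceil>"
    have L: "L > 0" using False assms by (simp add: L_def)
    have e: "gap x0 * exp (- L) = \<epsilon>" using False assms by (simp add: L_def exp_minus)
    have T_ge: "2 * (\<mu> + l) / \<mu> * L \<le> T" unfolding T_def by linarith
    have "contraction \<le> exp (- (\<mu> / (2 * (\<mu> + l))))"
      using exp_ge_add_one_self[of "- (\<mu> / (2 * (\<mu> + l)))"] by (simp add: contraction_def)
    then have "contraction ^ T \<le> exp (- (\<mu> / (2 * (\<mu> + l)))) ^ T"
      using contraction_bounds by (intro power_mono) auto
    also have "\<dots> = exp (- (T * (\<mu> / (2 * (\<mu> + l)))))"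
      by (simp add: exp_of_nat_mult[symmetric])
    also have "\<dots> \<le> exp (- L)"
      using T_ge \<mu>_pos l_pos by (simp add: field_simps)
    finally have "contraction ^ T * gap x0 \<le> gap x0 * exp (- L)"
      using gap_nonneg[of x0] by (simp add: mult.commute mult_left_mono)
    moreover have "real T \<le> appa_const * (of_int \<lceil>l / \<mu>\<rceil> * max 1 L)"
    proof -
      have "2 * (\<mu> + l) / \<mu> * L \<ge> 0" using L \<mu>_pos l_pos by simp
      then have "real T \<le> 2 * (\<mu> + l) / \<mu> * L + 1" unfolding T_def by linarith
      also have "2 * (\<mu> + l) / \<mu> = 2 + 2 * (l / \<mu>)" using \<mu>_pos by (simp add: field_simps)
      finally have "real T \<le> (2 + 2 * (l / \<mu>)) * L + 1" .
      \<comment> \<open>The constant 5 arises here: as the ceiling is at least 1, it absorbs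
        \<open>2 + 2 * (l / \<mu>)\<close> with factor 4, and the 1 lost by rounding
        \<open>T\<close> up costs one more multiple.\<close>
      moreover have "(2 + 2 * (l / \<mu>)) * L \<le> (4 * of_int \<lceil>l / \<mu>\<rceil>) * max 1 L"
        using L k le_of_int_ceiling[of "l / \<mu>"] by (intro mult_mono) linarith+
      moreover have "1 \<le> of_int \<lceil>l / \<mu>\<rceil> * max 1 L"
        using k mult_mono[of 1 "real_of_int \<lceil>l / \<mu>\<rceil>" 1 "max 1 L"] by simp
      ultimately show ?thesis unfolding appa_const_def by linarith
    qed
    ultimately show ?thesis using e by (intro that[of T]) (simp_all add: L_def)
  qed
qed

end

theorem theorem2p5:
  fixes n :: nat and \<psi> :: "nat \<Rightarrow> real ^ 'd \<Rightarrow> real" and F :: "real ^ 'd \<Rightarrow> real"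
    and \<mu> l \<epsilon> \<epsilon>0 :: real and x0 :: "real ^ 'd"
  assumes "F = (\<lambda>x. \<Sum>i=1..n. \<psi> i x)"
    and "\<mu> > 0" and "strongly_convex \<mu> F"
    and "l > 0"
    and "\<epsilon> > 0" and "\<epsilon>0 = F x0 - min_value F"
  shows "\<exists>T.
    (\<forall>P \<tau>. primal_oracle F (2 * (\<mu> + l) / \<mu>) l \<tau> P \<longrightarrow>
       approx_minimizer F \<epsilon> (fst (appa P x0 T)) \<and>
       snd (appa P x0 T) \<le> appa_time_bound \<tau> l \<mu> \<epsilon>0 \<epsilon>) \<and>
    (\<forall>P \<tau>. randomized_primal_oracle F (2 * (\<mu> + l) / \<mu>) l \<tau> P \<longrightarrow>
       expected_approx_minimizer F \<epsilon> (distr (randomized_appa P x0 T) borel fst) \<and>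
       (AE (x, s) in randomized_appa P x0 T. s \<le> appa_time_bound \<tau> l \<mu> \<epsilon>0 \<epsilon>))"
proof -
  interpret proximal_problem F \<mu> l
    using assms by unfold_locales
  have \<epsilon>0: "\<epsilon>0 = gap x0" using assms(6) by (simp only: gap_def)
  \<comment> \<open>\<open>T\<close> is fixed before any oracle is given, so the same count serves
    every deterministic and randomized \<open>P\<close>.\<close>
  obtain T :: nat where T: "contraction ^ T * gap x0 \<le> \<epsilon>"
    "real T \<le> appa_const * (of_int \<lceil>l / \<mu>\<rceil> * max 1 (ln (gap x0 / \<epsilon>)))"
    using iteration_count[OF \<open>\<epsilon> > 0\<close>] by blast
  have time: "T * \<tau> \<le> appa_time_bound \<tau> l \<mu> \<epsilon>0 \<epsilon>" if "0 \<le> \<tau>" for \<tau> :: real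
    using mult_right_mono[OF T(2) that] by (simp add: appa_time_bound_def \<epsilon>0 mult_ac)
  show ?thesis
  proof (intro exI[of _ T] conjI allI impI)
    fix P :: "real ^ 'd \<Rightarrow> (real ^ 'd) \<times> real" and \<tau>
    assume P: "primal_oracle F (2 * (\<mu> + l) / \<mu>) l \<tau> P"
    then have "0 \<le> \<tau>" unfolding primal_oracle_def by (meson order_trans)
    with appa_contraction[OF P, of x0 T] T(1) time
    show "approx_minimizer F \<epsilon> (fst (appa P x0 T))"
      "snd (appa P x0 T) \<le> appa_time_bound \<tau> l \<mu> \<epsilon>0 \<epsilon>"
      unfolding approx_minimizer_def gap_def by force+
  next
    fix P :: "real ^ 'd \<Rightarrow> ((real ^ 'd) \<times> real) measure" and \<tau>
    assume P: "randomized_primal_oracle F (2 * (\<mu> + l) / \<mu>) l \<tau> P"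
    show "expected_approx_minimizer F \<epsilon> (distr (randomized_appa P x0 T) borel fst)"
      by (rule randomized_appa_expected_approx_minimizer[OF P T(1)])
    show "AE (x, s) in randomized_appa P x0 T. s \<le> appa_time_bound \<tau> l \<mu> \<epsilon>0 \<epsilon>"
      using randomized_appa_contraction(3)[OF P, where ?x0.0 = x0 and T = T]
      by eventually_elim (use time[OF randomized_oracle_time_nonneg[OF P]] in auto)
  qed
qed

end
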